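(* Let $\alpha$ be a concave modulus, let $f\in\mathrm{Diff}_+^{1,\alpha}(S^1)$ be an exceptional diffeomorphism, let $\{J_i\}_{i\in\mathbb Z}$ be a maximal wandering set for $f$, and let $\ell_i$ be the length of $J_i$. Suppose that $\ell_{i+1}/\ell_i\to 1$ as $i\to\infty$. Then \[\int_0^1\frac{\alpha^{-1}(t)}{t^2}\,dt<\infty.\]
   Context: $S^1=\mathbb R/\mathbb Z$, and $|x-y|$ for $x,y\in S^1$ is the distance modulo $1$. A concave modulus is a homeomorphism $\alpha\colon[0,\infty)\to[0,\infty)$ that is concave; $\alpha^{-1}$ is its inverse function. A function $g\colon S^1\to\mathbb R$ is $\alpha$-continuous if $\sup_{x\neq y}|g(x)-g(y)|/\alpha(|x-y|)<\infty$. $\mathrm{Diff}_+^{1,\alpha}(S^1)$ is the group of orientation-preserving $C^1$ diffeomorphisms of $S^1$ with $\alpha$-continuous derivative. An exceptional diffeomorphism is one with irrational rotation number having an exceptional minimal set $K$, i.e. a minimal closed invariant set homeomorphic to a Cantor set. A maximal wandering set for $f$ is a family $\{J_i\}_{i\in\mathbb Z}$ of pairwise disjoint open intervals in $S^1\setminus K$ with $f(J_i)=J_{i+1}$ for all $i$, such that any interval properly containing some $J_i$ meets $K$ (so the family is the $f$-orbit of one connected component of $S^1\setminus K$, and need not be unique). *)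

theory Defs
  imports "HOL-Analysis.Analysis"
begin

section \<open>The circle as the metric space of reals modulo the integers\<close>

lemma equivp_diff_Ints: "equivp (\<lambda>x y :: real. x - y \<in> \<int>)"
proof (rule equivpI)
  show "symp (\<lambda>x y :: real. x - y \<in> \<int>)"
    by (rule sympI) (metis Ints_minus minus_diff_eq)
  show "transp (\<lambda>x y :: real. x - y \<in> \<int>)"
  proof (rule transpI)
    fix x y z :: real
    assume "x - y \<in> \<int>" "y - z \<in> \<int>"
    then have "(x - y) + (y - z) \<in> \<int>" by (rule Ints_add)
    then show "x - z \<in> \<int>" by simp
  qed
qed (auto intro: reflpI)

quotient_type circle = real / "\<lambda>x y :: real. x - y \<in> \<int>"
  by (rule equivp_diff_Ints)

lift_definition proj :: "real \<Rightarrow> circle" is "\<lambda>x. x" .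

lemma proj_eq_iff: "proj x = proj y \<longleftrightarrow> x - y \<in> \<int>"
  by transfer simp

lemma proj_surj: "\<exists>x. proj x = p"
proof transfer
  fix p :: real
  show "\<exists>x. x - p \<in> \<int>" by (rule exI[of _ p]) simp
qed

lemma infdist_Ints_minus: "infdist (- x) (\<int> :: real set) = infdist x \<int>"
proof -
  have le: "infdist (- x) (\<int> :: real set) \<le> infdist x \<int>" for x
  proof -
    obtain m :: real where m: "m \<in> \<int>" "infdist x \<int> = dist x m"
      using infdist_attains_inf[of "\<int> :: real set" x] by (auto intro: Ints_0)
    then have "infdist (- x) (\<int> :: real set) \<le> dist (- x) (- m)"
      by (intro infdist_le) auto
    then show ?thesis using m by (simp add: dist_real_def)
  qed
  show ?thesis using le[of x] le[of "- x"] by simp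
qed

lemma infdist_Ints_add:
  "infdist (x + y) (\<int> :: real set) \<le> infdist x \<int> + infdist y \<int>"
proof -
  have "\<exists>m\<in>\<int>. infdist u \<int> = dist u m" for u :: real
    using infdist_attains_inf[of "\<int> :: real set" u] by (metis Ints_0 closed_Ints empty_iff)
  then obtain m n :: real where mn: "m \<in> \<int>" "infdist x \<int> = dist x m"
      "n \<in> \<int>" "infdist y \<int> = dist y n" by meson
  then have "infdist (x + y) (\<int> :: real set) \<le> dist (x + y) (m + n)"
    by (intro infdist_le) auto
  then show ?thesis using mn by (simp add: dist_real_def)
qed

lemma infdist_Ints_eq_0_iff: "infdist x (\<int> :: real set) = 0 \<longleftrightarrow> x \<in> \<int>"
  using in_closed_iff_infdist_zero[of "\<int> :: real set" x] by (auto intro: Ints_0)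

instantiation circle :: metric_space
begin

lift_definition dist_circle :: "circle \<Rightarrow> circle \<Rightarrow> real"
  is "\<lambda>x y. infdist (x - y) \<int>"
proof -
  fix x x' y y' :: real
  assume a: "x - x' \<in> \<int>" "y - y' \<in> \<int>"
  have le: "infdist u (\<int> :: real set) \<le> infdist v \<int>" if "u - v \<in> \<int>" for u v :: real
    using infdist_Ints_add[of "u - v" v] infdist_Ints_eq_0_iff[of "u - v"] that by simp
  have "(x - x') - (y - y') \<in> \<int>" "(y - y') - (x - x') \<in> \<int>" using a by (auto intro: Ints_diff)
  then have "(x - y) - (x' - y') \<in> \<int>" "(x' - y') - (x - y) \<in> \<int>"
    by (simp_all add: algebra_simps)
  then show "infdist (x - y) (\<int> :: real set) = infdist (x' - y') \<int>"
    using le by (intro antisym) auto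
qed

definition uniformity_circle :: "(circle \<times> circle) filter"
  where "uniformity_circle = (INF e\<in>{0<..}. principal {(x, y). dist x y < e})"

definition open_circle :: "circle set \<Rightarrow> bool"
  where "open_circle U \<longleftrightarrow> (\<forall>x\<in>U. eventually (\<lambda>(x', y). x' = x \<longrightarrow> y \<in> U) uniformity)"

instance
proof
  fix x y z :: circle
  show "dist x y = 0 \<longleftrightarrow> x = y"
    by transfer (simp add: infdist_Ints_eq_0_iff)
  show "dist x y \<le> dist x z + dist y z"
  proof transfer
    fix x y z :: real
    show "infdist (x - y) (\<int> :: real set) \<le> infdist (x - z) \<int> + infdist (y - z) \<int>"
      using infdist_Ints_add[of "x - z" "z - y"] infdist_Ints_minus[of "y - z"] by simp
  qed
qed (simp_all add: uniformity_circle_def open_circle_def)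

end

lemma dist_proj: "dist (proj x) (proj y) = infdist (x - y) \<int>"
  by transfer simp

section \<open>Moduli of continuity\<close>

definition concave_modulus :: "(real \<Rightarrow> real) \<Rightarrow> bool"
  where "concave_modulus \<alpha> \<longleftrightarrow>
    (\<exists>\<beta>. homeomorphism {0..} {0..} \<alpha> \<beta>) \<and> concave_on {0..} \<alpha>"

definition modulus_continuous :: "(real \<Rightarrow> real) \<Rightarrow> (circle \<Rightarrow> real) \<Rightarrow> bool"
  where "modulus_continuous \<alpha> g \<longleftrightarrow>
    bdd_above {\<bar>g x - g y\<bar> / \<alpha> (dist x y) | x y. x \<noteq> y}"

section \<open>Circle diffeomorphisms\<close>

definition is_lift :: "(real \<Rightarrow> real) \<Rightarrow> (circle \<Rightarrow> circle) \<Rightarrow> bool"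
  where "is_lift F f \<longleftrightarrow> continuous_on UNIV F \<and> (\<forall>x. proj (F x) = f (proj x))"

definition circle_C1 :: "(circle \<Rightarrow> circle) \<Rightarrow> bool"
  where "circle_C1 f \<longleftrightarrow> (\<exists>F. is_lift F f \<and> F C1_differentiable_on UNIV)"

text \<open>The derivative is read off from any lift; the next two lemmas show that neither
  the lift nor the representative of the point matters.\<close>

definition circle_deriv :: "(circle \<Rightarrow> circle) \<Rightarrow> circle \<Rightarrow> real"
  where "circle_deriv f p =
    (THE d. \<exists>F x. is_lift F f \<and> proj x = p \<and> (F has_real_derivative d) (at x))"

lemma is_lift_unique:
  assumes "is_lift F f" "is_lift G f"
  obtains c where "c \<in> \<int>" "\<And>x. G x = F x + c"
proof -
  have Z: "G x - F x \<in> \<int>" for x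
    using assms unfolding is_lift_def by (metis proj_eq_iff)
  have "(\<lambda>x. G x - F x) constant_on UNIV"
  proof (rule continuous_discrete_range_constant)
    show "continuous_on UNIV (\<lambda>x. G x - F x)"
      using assms unfolding is_lift_def by (auto intro: continuous_on_diff)
    fix x :: real
    have "1 \<le> norm ((G y - F y) - (G x - F x))" if "G y - F y \<noteq> G x - F x" for y
      using Ints_nonzero_abs_ge1[OF Ints_diff[OF Z[of y] Z[of x]]] that by simp
    then show "\<exists>e>0. \<forall>y. y \<in> UNIV \<and> G y - F y \<noteq> G x - F x \<longrightarrow>
        e \<le> norm ((G y - F y) - (G x - F x))"
      by (intro exI[of _ 1]) auto
  qed auto
  then obtain c where "\<And>x. G x - F x = c" by (auto simp: constant_on_def)
  then show thesis using Z[of 0] by (intro that[of c]) (auto simp: algebra_simps)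
qed

lemma circle_deriv_proj:
  assumes F: "is_lift F f" and d: "(F has_real_derivative d) (at x)"
  shows "circle_deriv f (proj x) = d"
  unfolding circle_deriv_def
proof (rule the_equality)
  show "\<exists>F y. is_lift F f \<and> proj y = proj x \<and> (F has_real_derivative d) (at y)"
    using assms by blast
  fix d'
  assume "\<exists>F y. is_lift F f \<and> proj y = proj x \<and> (F has_real_derivative d') (at y)"
  then obtain G y where G: "is_lift G f" and y: "proj y = proj x"
    and d': "(G has_real_derivative d') (at y)" by blast
  define n where "n = y - x"
  have n: "n \<in> \<int>" using y by (simp add: n_def proj_eq_iff)
  have "proj (z + n) = proj z" for z using n by (simp add: proj_eq_iff)
  then have "is_lift (\<lambda>z. G (z + n)) f"
    using G unfolding is_lift_def
    by (auto intro!: continuous_intros continuous_on_compose2[of UNIV G])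
  then obtain c where c: "\<And>z. G (z + n) = F z + c"
    using is_lift_unique[OF F] by blast
  have "((\<lambda>z. G (z + n)) has_real_derivative d') (at x)"
    using d' DERIV_shift[of G d' x n] by (simp add: n_def)
  moreover have "((\<lambda>z. G (z + n)) has_real_derivative d) (at x)"
    unfolding c using DERIV_add[OF d DERIV_const[of c]] by simp
  ultimately show "d' = d" by (rule DERIV_unique)
qed

definition Diff_plus :: "(real \<Rightarrow> real) \<Rightarrow> (circle \<Rightarrow> circle) set"
  where "Diff_plus \<alpha> = {f. bij f \<and> circle_C1 f \<and> circle_C1 (inv f) \<and>
    (\<exists>F. is_lift F f \<and> strict_mono F) \<and> modulus_continuous \<alpha> (circle_deriv f)}"

text \<open>Replacing a lift by another one changes the limit by an integer, so the
  rotation number is a point of the circle.\<close>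

definition rotation_number :: "(circle \<Rightarrow> circle) \<Rightarrow> circle"
  where "rotation_number f = (THE r. \<exists>F t. is_lift F f \<and>
    (\<forall>x. (\<lambda>n. ((F ^^ n) x - x) / real n) \<longlonglongrightarrow> t) \<and> r = proj t)"

section \<open>Exceptional diffeomorphisms and wandering sets\<close>

fun cantor_stage :: "nat \<Rightarrow> real set"
  where
    "cantor_stage 0 = {0..1}"
  | "cantor_stage (Suc n) =
      (\<lambda>x. x / 3) ` cantor_stage n \<union> (\<lambda>x. (2 + x) / 3) ` cantor_stage n"

definition cantor_set :: "real set"
  where "cantor_set = (\<Inter>n. cantor_stage n)"

definition minimal_set :: "(circle \<Rightarrow> circle) \<Rightarrow> circle set \<Rightarrow> bool"
  where "minimal_set f K \<longleftrightarrow> closed K \<and> K \<noteq> {} \<and> f ` K = K \<and>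
    (\<forall>L. closed L \<and> L \<noteq> {} \<and> f ` L = L \<and> L \<subseteq> K \<longrightarrow> L = K)"

definition exceptional_minimal_set :: "(circle \<Rightarrow> circle) \<Rightarrow> circle set \<Rightarrow> bool"
  where "exceptional_minimal_set f K \<longleftrightarrow> minimal_set f K \<and> K homeomorphic cantor_set"

definition exceptional :: "(circle \<Rightarrow> circle) \<Rightarrow> bool"
  where "exceptional f \<longleftrightarrow>
    rotation_number f \<notin> proj ` \<rat> \<and> (\<exists>K. exceptional_minimal_set f K)"

definition circle_interval :: "circle set \<Rightarrow> bool"
  where "circle_interval A \<longleftrightarrow> (\<exists>I. is_interval I \<and> A = proj ` I)"

definition open_circle_interval :: "circle set \<Rightarrow> bool"
  where "open_circle_interval A \<longleftrightarrow>
    (\<exists>a b. a < b \<and> b \<le> a + 1 \<and> A = proj ` {a<..<b})"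

definition circle_length :: "circle set \<Rightarrow> real"
  where "circle_length A = measure lborel {x \<in> {0..<1}. proj x \<in> A}"

lemma circle_length_interval:
  assumes "a < b" "b \<le> a + 1"
  shows "circle_length (proj ` {a<..<b}) = b - a"
proof -
  define m where "m = real_of_int \<lfloor>a\<rfloor>"
  have m: "m \<in> \<int>" "m \<le> a" "a < m + 1" by (auto simp: m_def)
  define A where "A = {a - m<..<min (b - m) 1}"
  define B where "B = {0..<b - m - 1}"
  have "{x \<in> {0..<1}. proj x \<in> proj ` {a<..<b}} = A \<union> B"
  proof (intro equalityI subsetI)
    fix x assume x: "x \<in> {x \<in> {0..<1}. proj x \<in> proj ` {a<..<b}}"
    then obtain y where y: "a < y" "y < b" "x - y \<in> \<int>"
      by (auto simp: proj_eq_iff)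
    have "x - y + m \<in> \<int>" using y m by (intro Ints_add) auto
    then obtain k where k: "x - y + m = real_of_int k" by (auto elim: Ints_cases)
    have "real_of_int k < 1" "real_of_int k > -2"
      using k x y m assms by auto
    then have "k = 0 \<or> k = -1" by linarith
    then show "x \<in> A \<union> B"
      using k x y m assms by (auto simp: A_def B_def)
  next
    fix x assume "x \<in> A \<union> B"
    then show "x \<in> {x \<in> {0..<1}. proj x \<in> proj ` {a<..<b}}"
    proof
      assume x: "x \<in> A"
      have "proj x = proj (x + m)" using m by (simp add: proj_eq_iff)
      moreover have "x + m \<in> {a<..<b}" using x by (auto simp: A_def)
      ultimately have "proj x \<in> proj ` {a<..<b}" by (metis imageI)
      then show ?thesis using x m by (auto simp: A_def)
    next
      assume x: "x \<in> B"
      have "x - (x + m + 1) \<in> \<int>" using m by auto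
      then have "proj x = proj (x + m + 1)" by (simp only: proj_eq_iff)
      moreover have "x + m + 1 \<in> {a<..<b}" using x m by (auto simp: B_def)
      ultimately have "proj x \<in> proj ` {a<..<b}" by (metis imageI)
      then show ?thesis using x m assms by (auto simp: B_def)
    qed
  qed
  moreover have eA: "emeasure lborel A = ennreal (min (b - m) 1 - (a - m))"
    unfolding A_def using assms m by (intro emeasure_lborel_Ioo) auto
  moreover have eB: "emeasure lborel B = ennreal (max 0 (b - m - 1))"
    by (cases "0 \<le> b - m - 1") (auto simp: B_def max_def)
  ultimately have "circle_length (proj ` {a<..<b}) = measure lborel (A \<union> B)"
    by (simp add: circle_length_def)
  also have "\<dots> = measure lborel A + measure lborel B"
  proof (rule measure_Union)
    show "A \<inter> B = {}" using assms by (auto simp: A_def B_def)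
  qed (use eA eB in \<open>auto simp: A_def B_def\<close>)
  also have "\<dots> = b - a"
    using assms m by (auto simp: measure_def eA eB min_def max_def)
  finally show ?thesis .
qed

definition maximal_wandering_set ::
    "(circle \<Rightarrow> circle) \<Rightarrow> circle set \<Rightarrow> (int \<Rightarrow> circle set) \<Rightarrow> bool"
  where "maximal_wandering_set f K J \<longleftrightarrow>
    (\<forall>i. open_circle_interval (J i) \<and> J i \<subseteq> - K) \<and>
    (\<forall>i j. i \<noteq> j \<longrightarrow> J i \<inter> J j = {}) \<and>
    (\<forall>i. f ` J i = J (i + 1)) \<and>
    (\<forall>i A. circle_interval A \<and> J i \<subset> A \<longrightarrow> A \<inter> K \<noteq> {})"

end

theory Submission
  imports Defs
begin

text \<open>The left endpoint \<open>x\<close> of \<open>J 0\<close> lies in \<open>K\<close>, and by minimality its forward orbit is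
  recurrent: every point of \<open>K\<close> is a limit of \<open>(f ^^ k) x\<close> with \<open>k\<close> arbitrarily large. The mean
  value theorem puts \<open>l (k + 1) / l k\<close> within \<open>C * \<alpha> (l k)\<close> of \<open>f'\<close> at \<open>(f ^^ k) x\<close>, so
  \<open>l (k + 1) / l k \<longlonglongrightarrow> 1\<close> forces \<open>f' = 1\<close> on \<open>K\<close>, and feeding this back gives the rate
  \<open>\<bar>l (k + 1) / l k - 1\<bar> \<le> C * \<alpha> (l k)\<close>. As \<open>l k\<close> tends to \<open>0\<close>, the intervals
  \<open>(\<alpha> (l (k + 1)), \<alpha> (l k)]\<close> cover a right neighbourhood of \<open>0\<close>; by concavity the integral over
  the \<open>k\<close>-th one is at most \<open>4 * C * l k\<close>, and the lengths \<open>l k\<close> are summable.\<close>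

section \<open>Concave moduli\<close>

lemma concave_modulus_nonneg:
  assumes "concave_modulus \<alpha>" "0 \<le> x"
  shows "0 \<le> \<alpha> x"
  using assms by (auto simp: concave_modulus_def homeomorphism_def)

lemma concave_modulus_inj:
  assumes "concave_modulus \<alpha>"
  shows "inj_on \<alpha> {0..}"
  using assms unfolding concave_modulus_def homeomorphism_def
  by (auto intro: inj_on_inverseI)

lemma concave_modulus_image:
  assumes "concave_modulus \<alpha>"
  shows "\<alpha> ` {0..} = {0..}"
  using assms by (auto simp: concave_modulus_def homeomorphism_def)

text \<open>A concave function that decreases once stays below a line of negative slope from then on
  and becomes negative, which a map into \<open>{0..}\<close> cannot. Injectivity makes the
  inequality strict.\<close>

lemma concave_modulus_less:
  assumes \<alpha>: "concave_modulus \<alpha>" and xy: "0 \<le> x" "x < y"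
  shows "\<alpha> x < \<alpha> y"
proof -
  have "\<alpha> x \<noteq> \<alpha> y"
    using concave_modulus_inj[OF \<alpha>] xy by (auto dest: inj_onD)
  moreover have "\<alpha> x \<le> \<alpha> y"
  proof (rule ccontr)
    assume "\<not> \<alpha> x \<le> \<alpha> y"
    then have d: "\<alpha> x - \<alpha> y > 0" by simp
    \<comment> \<open>The line through the graph points over \<open>x\<close> and \<open>y\<close>
      vanishes at \<open>(y * \<alpha> x - x * \<alpha> y) / (\<alpha> x - \<alpha> y)\<close>. The
      choice of \<open>z\<close> puts it beyond both \<open>y\<close> and this zero.\<close>
    define z where "z = y + 1 + \<bar>y * \<alpha> x - x * \<alpha> y\<bar> / (\<alpha> x - \<alpha> y)"
    have z: "y < z" using d by (simp add: z_def add_pos_nonneg)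
    have cv: "convex_on {0..} (\<lambda>t. - \<alpha> t)"
      using \<alpha> by (simp add: concave_modulus_def concave_on_def)
    define u where "u = (y - x) / (z - x)"
    have u: "0 \<le> u" "u \<le> 1" using xy z by (auto simp: u_def divide_simps)
    have "u * (z - x) = y - x" using xy z by (simp add: u_def)
    then have y: "(1 - u) *\<^sub>R x + u *\<^sub>R z = y" by (simp add: algebra_simps)
    have "- \<alpha> y \<le> (1 - u) * (- \<alpha> x) + u * (- \<alpha> z)"
      using convex_onD[OF cv u, of x z] xy z by (simp only: y) auto
    moreover have "u * \<alpha> z \<ge> 0" using u concave_modulus_nonneg[OF \<alpha>, of z] xy z by simp
    ultimately have "(1 - u) * \<alpha> x \<le> \<alpha> y" by (simp add: algebra_simps)
    moreover have "1 - u = (z - y) / (z - x)" using xy z by (simp add: u_def field_simps)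
    ultimately have "(z - y) * \<alpha> x \<le> (z - x) * \<alpha> y"
      using xy z by (simp add: field_simps)
    then have "z * (\<alpha> x - \<alpha> y) \<le> y * \<alpha> x - x * \<alpha> y" by (simp add: algebra_simps)
    moreover have "z * (\<alpha> x - \<alpha> y) = (y + 1) * (\<alpha> x - \<alpha> y) + \<bar>y * \<alpha> x - x * \<alpha> y\<bar>"
      using d by (simp add: z_def field_simps)
    moreover have "(y + 1) * (\<alpha> x - \<alpha> y) > 0" using d xy by (intro mult_pos_pos) auto
    ultimately show False by linarith
  qed
  ultimately show ?thesis by simp
qed

lemma concave_modulus_mono:
  assumes "concave_modulus \<alpha>" "0 \<le> x" "x \<le> y"
  shows "\<alpha> x \<le> \<alpha> y"
  using concave_modulus_less[OF assms(1,2), of y] assms(3) by (cases "x = y") auto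

lemma concave_modulus_zero:
  assumes \<alpha>: "concave_modulus \<alpha>"
  shows "\<alpha> 0 = 0"
proof -
  have "0 \<in> \<alpha> ` {0..}" using concave_modulus_image[OF \<alpha>] by simp
  then obtain s where "0 \<le> s" "\<alpha> s = 0" by auto
  then show ?thesis
    using concave_modulus_mono[OF \<alpha>, of 0 s] concave_modulus_nonneg[OF \<alpha>, of 0] by simp
qed

lemma concave_modulus_pos:
  assumes "concave_modulus \<alpha>" "0 < x"
  shows "0 < \<alpha> x"
  using concave_modulus_less[OF assms(1), of 0 x] concave_modulus_zero[OF assms(1)] assms(2)
  by simp

text \<open>Since \<open>\<alpha> 0 = 0\<close>, concavity on the segment from \<open>0\<close> to
  \<open>a\<close> makes \<open>\<alpha> t / t\<close> nonincreasing. The form without division also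
  covers \<open>a = 0\<close> and \<open>b = 0\<close>.\<close>

lemma concave_modulus_ratio:
  assumes \<alpha>: "concave_modulus \<alpha>" and ab: "0 \<le> b" "b \<le> a"
  shows "b * \<alpha> a \<le> a * \<alpha> b"
proof (cases "a = 0")
  case False
  with ab have a: "a > 0" by simp
  have cv: "convex_on {0..} (\<lambda>t. - \<alpha> t)"
    using \<alpha> by (simp add: concave_modulus_def concave_on_def)
  have u: "0 \<le> b / a" "b / a \<le> 1" using ab a by auto
  have "- \<alpha> b \<le> (b / a) * (- \<alpha> a)"
    using convex_onD[OF cv u, of 0 a] ab a concave_modulus_zero[OF \<alpha>] by simp
  then show ?thesis using a by (simp add: field_simps)
qed (use ab in auto)

lemma concave_modulus_tendsto_zero:
  assumes \<alpha>: "concave_modulus \<alpha>" and u: "u \<longlonglongrightarrow> 0" "\<And>n::nat. 0 \<le> u n"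
  shows "(\<lambda>n. \<alpha> (u n)) \<longlonglongrightarrow> 0"
proof -
  have "continuous_on {0..} \<alpha>"
    using \<alpha> by (auto simp: concave_modulus_def homeomorphism_def)
  then have "(\<lambda>n. \<alpha> (u n)) \<longlonglongrightarrow> \<alpha> 0"
    by (rule continuous_on_tendsto_compose[OF _ u(1)]) (use u(2) in auto)
  then show ?thesis using concave_modulus_zero[OF \<alpha>] by simp
qed

lemma concave_modulus_inv_into:
  assumes \<alpha>: "concave_modulus \<alpha>" and t: "0 \<le> t"
  shows "0 \<le> inv_into {0..} \<alpha> t" "\<alpha> (inv_into {0..} \<alpha> t) = t"
proof -
  have "t \<in> \<alpha> ` {0..}" using concave_modulus_image[OF \<alpha>] t by simp
  then show "0 \<le> inv_into {0..} \<alpha> t" "\<alpha> (inv_into {0..} \<alpha> t) = t"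
    using inv_into_into[of t \<alpha> "{0..}"] by (auto intro: f_inv_into_f)
qed

lemma concave_modulus_inv_into_le:
  assumes \<alpha>: "concave_modulus \<alpha>" and "0 \<le> t" "0 \<le> x" "t \<le> \<alpha> x"
  shows "inv_into {0..} \<alpha> t \<le> x"
  using concave_modulus_less[OF \<alpha>, of x "inv_into {0..} \<alpha> t"]
    concave_modulus_inv_into[OF \<alpha>, of t] assms by fastforce

text \<open>The analytic half of the argument, with no dynamics left. The lengths need not decrease,
  so the integrand is dominated by a sum over pieces that may be empty or overlap: only covering
  matters for an upper bound.\<close>

lemma integrable_inverse_modulus:
  fixes l :: "nat \<Rightarrow> real"
  assumes \<alpha>: "concave_modulus \<alpha>" and pos: "\<And>k. 0 < l k" and sl: "summable l"
    and C: "0 \<le> C" and rate: "\<And>k. l k - l (Suc k) \<le> C * l k * \<alpha> (l k)"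
    and half: "\<And>k. l k \<le> 2 * l (Suc k)"
  shows "(\<integral>\<^sup>+ t\<in>{0<..<1}. ennreal (inv_into {0..} \<alpha> t / t\<^sup>2) \<partial>lborel) < \<infinity>"
proof -
  define g where "g = inv_into {0..} \<alpha>"
  \<comment> \<open>On \<open>A k\<close> the constant \<open>c k\<close> bounds the integrand: the
    numerator is taken at the right end and the denominator at the left end. In the same way
    \<open>d\<close> serves for \<open>t\<close> between \<open>\<alpha> (l 0)\<close> and
    \<open>1\<close>.\<close>
  define c where "c k = l k / (\<alpha> (l (Suc k)))\<^sup>2" for k
  define A where "A k = {\<alpha> (l (Suc k))<..\<alpha> (l k)}" for k
  define d where "d = g 1 / (\<alpha> (l 0))\<^sup>2"
  define h where "h t = (\<Sum>k. ennreal (c k) * indicator (A k) t)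
      + ennreal d * indicator {\<alpha> (l 0)..1} t" for t
  have \<alpha>pos: "0 < \<alpha> (l k)" for k by (rule concave_modulus_pos[OF \<alpha> pos])
  have cpos: "0 \<le> c k" for k using pos[of k] by (simp add: c_def)
  have \<alpha>l0: "(\<lambda>k. \<alpha> (l k)) \<longlonglongrightarrow> 0"
    using concave_modulus_tendsto_zero[OF \<alpha> summable_LIMSEQ_zero[OF sl]] pos less_imp_le by blast
  have bound: "ennreal (g t / t\<^sup>2) * indicator {0<..<1} t \<le> h t" for t
  proof (cases "t \<in> {0<..<1}")
    case t: True
    show ?thesis
    proof (cases "\<alpha> (l 0) < t")
      case True
      have "g t \<le> g 1"
        unfolding g_def
        by (rule concave_modulus_inv_into_le[OF \<alpha>])
          (use t concave_modulus_inv_into[OF \<alpha>, of 1] in auto)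
      moreover have "0 \<le> g 1" using concave_modulus_inv_into[OF \<alpha>, of 1] by (simp add: g_def)
      ultimately have "g t / t\<^sup>2 \<le> d"
        unfolding d_def using True \<alpha>pos[of 0] by (intro frac_le power_mono) auto
      then have "ennreal (g t / t\<^sup>2) \<le> ennreal d * indicator {\<alpha> (l 0)..1} t"
        using t True by (auto simp: ennreal_leI)
      also have "\<dots> \<le> h t" unfolding h_def by simp
      finally show ?thesis using t by simp
    next
      case False
      have "\<exists>k. \<alpha> (l (Suc k)) < t"
        using order_tendstoD(2)[OF LIMSEQ_Suc[OF \<alpha>l0], of t] t
        by (auto simp: eventually_sequentially)
      \<comment> \<open>The sequence \<open>\<alpha> (l k)\<close> starts at or above
        \<open>t\<close> and is eventually below it, so it crosses \<open>t\<close> between two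
        consecutive indices, monotone or not.\<close>
      then have "\<exists>k. \<alpha> (l (Suc k)) < t \<and> t \<le> \<alpha> (l k)"
        using False by (metis not_less exists_least_lemma[of "\<lambda>k. \<alpha> (l k) < t"])
      then obtain k where k: "\<alpha> (l (Suc k)) < t" "t \<le> \<alpha> (l k)" by blast
      have "g t \<le> l k"
        unfolding g_def by (rule concave_modulus_inv_into_le[OF \<alpha>]) (use t k pos[of k] in auto)
      then have "g t / t\<^sup>2 \<le> c k"
        unfolding c_def using k \<alpha>pos[of "Suc k"] pos[of k] by (intro frac_le power_mono) auto
      then have "ennreal (g t / t\<^sup>2) \<le> ennreal (c k) * indicator (A k) t"
        using k by (auto simp: A_def ennreal_leI)
      also have "\<dots> \<le> (\<Sum>k. ennreal (c k) * indicator (A k) t)"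
        using sum_le_suminf[OF summableI, of "{k}" "\<lambda>k. ennreal (c k) * indicator (A k) t"]
        unfolding sum.insert_remove[OF finite.emptyI] by simp
      also have "\<dots> \<le> h t" unfolding h_def by simp
      finally show ?thesis using t by simp
    qed
  qed simp
  have piece: "ennreal (c k) * emeasure lborel (A k) \<le> ennreal (4 * C * l k)" for k
  proof (cases "l (Suc k) < l k")
    case True
    define a b where "a = l k" and "b = l (Suc k)"
    have ab: "0 < b" "b < a" "a \<le> 2 * b" using True pos half by (auto simp: a_def b_def)
    have p: "0 < \<alpha> b" "0 < \<alpha> a" using \<alpha>pos by (auto simp: a_def b_def)
    have ratio: "b * \<alpha> a \<le> a * \<alpha> b" using concave_modulus_ratio[OF \<alpha>, of b a] ab by simp
    have dbl: "\<alpha> a \<le> 2 * \<alpha> b"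
    proof -
      have "b * \<alpha> a \<le> b * (2 * \<alpha> b)"
        using ratio mult_right_mono[of a "2 * b" "\<alpha> b"] ab p by linarith
      then show ?thesis by (rule mult_left_le_imp_le) (rule ab(1))
    qed
    \<comment> \<open>By concavity the slope of the chord from \<open>b\<close> to \<open>a\<close>
      is at most that of the chord from \<open>0\<close> to \<open>b\<close>. This converts the
      decrease of the lengths, controlled by \<open>rate\<close>, into the length of
      \<open>A k\<close>.\<close>
    have "\<alpha> a - \<alpha> b \<le> (a - b) * \<alpha> b / b" using ratio ab by (simp add: field_simps)
    also have "\<dots> \<le> (C * a * \<alpha> a) * \<alpha> b / b"
      using rate[of k] ab p by (intro divide_right_mono mult_right_mono) (auto simp: a_def b_def)
    \<comment> \<open>The factor 4 arises from \<open>a \<le> 2 * b\<close> and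
      \<open>\<alpha> a \<le> 2 * \<alpha> b\<close>; the resulting square of
      \<open>\<alpha> b\<close> cancels the denominator of \<open>c k\<close>.\<close>
    also have "\<dots> \<le> (C * (2 * b) * (2 * \<alpha> b)) * \<alpha> b / b"
      using ab p dbl C by (intro divide_right_mono mult_right_mono mult_mono mult_left_mono) auto
    also have "\<dots> = 4 * C * (\<alpha> b)\<^sup>2" using ab by (simp add: power2_eq_square)
    finally have "a / (\<alpha> b)\<^sup>2 * (\<alpha> a - \<alpha> b) \<le> a / (\<alpha> b)\<^sup>2 * (4 * C * (\<alpha> b)\<^sup>2)"
      using ab by (intro mult_left_mono) auto
    then have "c k * (\<alpha> a - \<alpha> b) \<le> 4 * C * l k"
      using p by (simp add: c_def a_def b_def mult_ac)
    moreover have "\<alpha> b \<le> \<alpha> a" using concave_modulus_mono[OF \<alpha>, of b a] ab by simp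
    ultimately show ?thesis
      using cpos[of k] by (simp add: A_def a_def b_def flip: ennreal_mult) (simp add: ennreal_leI)
  next
    case False
    then have "A k = {}"
      using concave_modulus_mono[OF \<alpha>, of "l k" "l (Suc k)"] pos[of k] by (auto simp: A_def)
    then show ?thesis by simp
  qed
  have "(\<integral>\<^sup>+ t\<in>{0<..<1}. ennreal (g t / t\<^sup>2) \<partial>lborel) \<le> (\<integral>\<^sup>+ t. h t \<partial>lborel)"
    by (intro nn_integral_mono bound)
  also have "\<dots> = (\<Sum>k. ennreal (c k) * emeasure lborel (A k))
      + ennreal d * emeasure lborel {\<alpha> (l 0)..1}"
    unfolding h_def
    by (subst nn_integral_add; (subst nn_integral_suminf)?)
      (auto simp: A_def nn_integral_cmult_indicator)
  also have "\<dots> \<le> (\<Sum>k. ennreal (4 * C * l k)) + ennreal d * emeasure lborel {\<alpha> (l 0)..1}"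
    by (intro add_right_mono suminf_le piece) auto
  also have "\<dots> < \<infinity>"
  proof -
    have "(\<Sum>k. ennreal (4 * C * l k)) = ennreal (\<Sum>k. 4 * C * l k)"
      using sl C pos by (intro suminf_ennreal2) (auto intro: mult_nonneg_nonneg less_imp_le)
    moreover have "emeasure lborel {\<alpha> (l 0)..1} < \<infinity>"
      by (cases "\<alpha> (l 0) \<le> 1") auto
    ultimately show ?thesis by (auto simp: ennreal_mult_less_top)
  qed
  finally show ?thesis by (simp add: g_def)
qed

section \<open>Circle maps\<close>

lemma dist_proj_le: "dist (proj x) (proj y) \<le> \<bar>x - y\<bar>"
  using infdist_le[of 0 "\<int> :: real set" "x - y"] by (simp add: dist_proj dist_real_def)

text \<open>The integers are closed, so the infimum defining the distance is attained. This lifts a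
  point near \<open>proj x\<close> to a real number equally near \<open>x\<close>.\<close>

lemma dist_proj_attained:
  obtains y where "proj y = q" "dist (proj x) q = \<bar>x - y\<bar>"
proof -
  obtain z where z: "proj z = q" using proj_surj by blast
  obtain m :: real where m: "m \<in> \<int>" "infdist (x - z) \<int> = dist (x - z) m"
    using infdist_attains_inf[of "\<int> :: real set" "x - z"] by (auto intro: Ints_0)
  show thesis
  proof (rule that)
    show "proj (z + m) = q" using z m by (metis proj_eq_iff add_diff_cancel_left')
    show "dist (proj x) q = \<bar>x - (z + m)\<bar>"
      using z m dist_proj[of x z] by (simp add: dist_real_def algebra_simps)
  qed
qed

lemma continuous_proj: "continuous_on UNIV proj"
  unfolding continuous_on_iff
  by (metis dist_proj_le dist_real_def dist_commute order_le_less_trans)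

lemma compact_circle: "compact (UNIV :: circle set)"
proof -
  have "p \<in> proj ` {0..1}" for p
  proof -
    obtain x where x: "proj x = p" using proj_surj by blast
    have "proj (frac x) = p" using x by (auto simp: proj_eq_iff frac_def)
    then show ?thesis using frac_ge_0[of x] frac_lt_1[of x] by force
  qed
  then have "UNIV = proj ` {0..1}" by blast
  then show ?thesis
    using compact_continuous_image[OF continuous_on_subset[OF continuous_proj], of "{0..1}"]
    by simp
qed

lemma is_lift_continuous:
  assumes F: "is_lift F f"
  shows "continuous_on UNIV f"
  unfolding continuous_on_iff
proof (intro ballI allI impI)
  fix p :: circle and e :: real
  assume e: "e > 0"
  obtain x where x: "proj x = p" using proj_surj by blast
  have "continuous_on UNIV F" using F by (simp add: is_lift_def)
  then obtain d where d: "d > 0" "\<And>y. dist y x < d \<Longrightarrow> dist (F y) (F x) < e"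
    using e unfolding continuous_on_iff by (metis UNIV_I)
  have "dist (f q) (f p) < e" if q: "dist q p < d" for q
  proof -
    obtain y where y: "proj y = q" "dist (proj x) q = \<bar>x - y\<bar>" by (rule dist_proj_attained)
    have "dist (F y) (F x) < e" using d(2)[of y] y q x by (simp add: dist_commute dist_real_def)
    moreover have "dist (f q) (f p) \<le> \<bar>F y - F x\<bar>"
      using dist_proj_le[of "F y" "F x"] F x y by (simp add: is_lift_def)
    ultimately show ?thesis by (simp add: dist_real_def)
  qed
  then show "\<exists>d>0. \<forall>q\<in>UNIV. dist q p < d \<longrightarrow> dist (f q) (f p) < e" using d(1) by blast
qed

text \<open>The omega-limit set \<open>L\<close> of \<open>x\<close> is closed, invariant, contained
  in \<open>K\<close>, and nonempty by compactness, so minimality forces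
  \<open>L = K\<close>.\<close>

lemma minimal_set_recurrent:
  assumes K: "minimal_set f K" and f: "bij f" "continuous_on UNIV f" "continuous_on UNIV (inv f)"
    and x: "x \<in> K" and p: "p \<in> K"
  shows "p \<in> closure ((\<lambda>k. (f ^^ k) x) ` {n..})"
proof -
  define S where "S n = closure ((\<lambda>k. (f ^^ k) x) ` {n..})" for n
  define L where "L = (\<Inter>n. S n)"
  have inv: "inv f (f y) = y" "f (inv f y) = y" for y
    using f(1) by (simp_all add: bij_is_inj bij_is_surj surj_f_inv_f)
  have cK: "closed K" and fK: "f ` K = K" using K by (auto simp: minimal_set_def)
  have orb: "(f ^^ k) x \<in> K" for k using x fK by (induction k) auto
  have anti: "S n \<subseteq> S m" if "m \<le> n" for m n
    unfolding S_def using that by (intro closure_mono image_mono) auto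
  have S1: "f ` S n \<subseteq> S (Suc n)" for n
  proof -
    have "f ` S n \<subseteq> closure (f ` (\<lambda>k. (f ^^ k) x) ` {n..})"
      unfolding S_def by (rule continuous_image_closure_subset[OF f(2)]) auto
    also have "f ` (\<lambda>k. (f ^^ k) x) ` {n..} \<subseteq> (\<lambda>k. (f ^^ k) x) ` {Suc n..}"
      by (auto intro!: image_eqI[of _ _ "Suc _"])
    finally show ?thesis by (auto simp: S_def closure_mono dest: subsetD[OF closure_mono])
  qed
  have S2: "inv f ` S (Suc n) \<subseteq> S n" for n
  proof -
    have "inv f ` S (Suc n) \<subseteq> closure (inv f ` (\<lambda>k. (f ^^ k) x) ` {Suc n..})"
      unfolding S_def by (rule continuous_image_closure_subset[OF f(3)]) auto
    also have "\<dots> \<subseteq> S n"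
      unfolding S_def
    proof (rule closure_mono, safe)
      fix k assume "Suc n \<le> k"
      then have "inv f ((f ^^ k) x) = (f ^^ (k - 1)) x" "n \<le> k - 1"
        by (cases k; simp add: inv)+
      then show "inv f ((f ^^ k) x) \<in> (\<lambda>k. (f ^^ k) x) ` {n..}" by auto
    qed
    finally show ?thesis .
  qed
  have "f ` L = L"
  proof
    show "f ` L \<subseteq> L"
    proof -
      have "f y \<in> S n" if "y \<in> L" for y n
        using that S1[of n] anti[of n "Suc n"] by (auto simp: L_def)
      then show ?thesis by (auto simp: L_def)
    qed
    show "L \<subseteq> f ` L"
    proof
      fix y assume "y \<in> L"
      then have "inv f y \<in> L" using S2 by (auto simp: L_def)
      then show "y \<in> f ` L" using inv(2)[of y] by (metis imageI)
    qed
  qed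
  moreover have "closed L" by (auto simp: L_def S_def)
  moreover have "L \<noteq> {}"
    unfolding L_def
  \<comment> \<open>Finitely many tails with indices at most \<open>n\<close> share the point
    \<open>(f ^^ n) x\<close>, so compactness gives a common point of all their closures.\<close>
  proof (rule compact_imp_fip_image[OF compact_circle, simplified])
    fix I :: "nat set"
    assume "finite I"
    then obtain n where "I \<subseteq> {..n}" using finite_nat_iff_bounded_le by blast
    then have "(f ^^ n) x \<in> (\<Inter>i\<in>I. S i)"
      unfolding S_def by (auto intro!: subsetD[OF closure_subset])
    then show "(\<Inter>i\<in>I. S i) \<noteq> {}" by blast
  qed (auto simp: S_def)
  moreover have "L \<subseteq> K"
  proof -
    have "S 0 \<subseteq> K" unfolding S_def using orb cK by (intro closure_minimal) auto
    then show ?thesis by (auto simp: L_def)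
  qed
  ultimately have "L = K" using K unfolding minimal_set_def by blast
  then show ?thesis using p by (auto simp: L_def S_def)
qed

text \<open>The representatives in \<open>{0..<1}\<close> form disjoint sets inside an interval of
  measure 1, which bounds every partial sum.\<close>

lemma summable_circle_length_disjoint:
  fixes I :: "nat \<Rightarrow> circle set"
  assumes op: "\<And>k. open_circle_interval (I k)" and dj: "disjoint_family I"
  shows "summable (\<lambda>k. circle_length (I k))"
proof -
  define S where "S k = {x \<in> {0..<1}. proj x \<in> I k}" for k
  have meas: "S k \<in> sets lborel" for k
  proof -
    obtain a b where ab: "I k = proj ` {a<..<b}" using op[of k] by (auto simp: open_circle_interval_def)
    \<comment> \<open>Written as a union of integer translates, the preimage of a circle interval is
      visibly measurable.\<close>
    have "S k = {0..<1} \<inter> (\<Union>n::int. {a + n<..<b + n})"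
    proof (intro equalityI subsetI)
      fix x assume "x \<in> S k"
      then obtain y n where "0 \<le> x" "x < 1" "a < y" "y < b" "x - y = real_of_int n"
        unfolding S_def ab by (auto simp: proj_eq_iff) (metis Ints_cases)
      then show "x \<in> {0..<1} \<inter> (\<Union>n::int. {a + n<..<b + n})" by (auto intro!: exI[of _ n])
    next
      fix x assume "x \<in> {0..<1} \<inter> (\<Union>n::int. {a + n<..<b + n})"
      then obtain n :: int where n: "0 \<le> x" "x < 1" "a + n < x" "x < b + n" by auto
      have "proj x = proj (x - n)" by (simp add: proj_eq_iff)
      then show "x \<in> S k" using n by (auto simp: S_def ab)
    qed
    then show ?thesis by auto
  qed
  have fin: "emeasure lborel (S k) < \<infinity>" for k
  proof -
    have "emeasure lborel (S k) \<le> emeasure lborel {0..<1::real}"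
      by (intro emeasure_mono) (auto simp: S_def)
    then show ?thesis by (auto intro: le_less_trans)
  qed
  have djS: "disjoint_family S" using dj by (auto simp: S_def disjoint_family_on_def)
  have "summable (\<lambda>k. measure lborel (S k))"
  proof (rule summableI_nonneg_bounded)
    fix n
    have "(\<Sum>k<n. measure lborel (S k)) = measure lborel (\<Union>k<n. S k)"
      by (rule measure_finite_Union[symmetric])
        (use meas fin djS in \<open>auto simp: disjoint_family_on_def less_top\<close>)
    also have "\<dots> \<le> measure lborel {0..<1::real}"
      using meas by (intro measure_mono_fmeasurable) (auto simp: S_def fmeasurable_def)
    finally show "(\<Sum>k<n. measure lborel (S k)) \<le> measure lborel {0..<1::real}" .
  qed auto
  then show ?thesis by (simp add: circle_length_def S_def)
qed

text \<open>\<open>Diff_plus\<close> supplies an increasing lift and a C1 lift separately. They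
  differ by a constant, so the increasing one is differentiable too.\<close>

lemma Diff_plus_lift:
  assumes "f \<in> Diff_plus \<alpha>"
  obtains F where "is_lift F f" "strict_mono F"
    "\<And>x. (F has_real_derivative circle_deriv f (proj x)) (at x)"
proof -
  obtain F G where F: "is_lift F f" "strict_mono F" and G: "is_lift G f" "G C1_differentiable_on UNIV"
    using assms by (auto simp: Diff_plus_def circle_C1_def)
  obtain c where c: "\<And>x. F x = G x + c" using is_lift_unique[OF G(1) F(1)] by blast
  have "(F has_real_derivative circle_deriv f (proj x)) (at x)" for x
  proof -
    obtain D where "(G has_vector_derivative D) (at x)"
      using G(2) by (auto simp: C1_differentiable_on_def)
    then have "(G has_real_derivative D) (at x)"
      by (simp add: has_real_derivative_iff_has_vector_derivative)
    then have D: "(F has_real_derivative D) (at x)"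
      using DERIV_add[of G D x UNIV "\<lambda>_. c" 0] by (simp add: c[abs_def])
    then show ?thesis using circle_deriv_proj[OF F(1) D] by simp
  qed
  then show thesis using F that by blast
qed

lemma lift_image_interval:
  assumes F: "is_lift F f" "strict_mono F" and f: "inj f" and ab: "a < b" "b \<le> a + 1"
  shows "f ` proj ` {a<..<b} = proj ` {F a<..<F b}" "F a < F b" "F b \<le> F a + 1"
proof -
  have IVT: "\<exists>c. a < c \<and> c < b \<and> F c = y" if y: "F a < y" "y < F b" for y
  proof -
    have "continuous_on {a..b} F" using F by (auto simp: is_lift_def intro: continuous_on_subset)
    then obtain c where "a \<le> c" "c \<le> b" "F c = y" using IVT'[of F a y b] y ab by force
    moreover have "c \<noteq> a" "c \<noteq> b" using calculation y by auto
    ultimately show ?thesis by (intro exI[of _ c]) auto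
  qed
  have "F ` {a<..<b} = {F a<..<F b}"
    using IVT strict_monoD[OF F(2)] by (fastforce simp: image_iff)
  moreover have "f ` proj ` {a<..<b} = proj ` F ` {a<..<b}"
    using F(1) by (auto simp: is_lift_def image_image)
  ultimately show "f ` proj ` {a<..<b} = proj ` {F a<..<F b}" by simp
  show "F a < F b" using F ab by (simp add: strict_monoD)
  show "F b \<le> F a + 1"
  proof (rule ccontr)
    assume "\<not> F b \<le> F a + 1"
    \<comment> \<open>An image longer than 1 would contain both \<open>y\<close> and
      \<open>y - 1\<close>. Their preimages are distinct and less than 1 apart, yet \<open>f\<close>
      identifies their projections, against injectivity.\<close>
    then obtain y where y: "F a + 1 < y" "y < F b" using dense[of "F a + 1" "F b"] by auto
    obtain c where c: "a < c" "c < b" "F c = y" using IVT[of y] y by auto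
    obtain c' where c': "a < c'" "c' < b" "F c' = y - 1" using IVT[of "y - 1"] y by auto
    have "proj (F c) = proj (F c')" using c c' by (simp add: proj_eq_iff)
    then have "proj c = proj c'" using F(1) f by (simp add: is_lift_def inj_eq)
    then have "c - c' \<in> \<int>" by (simp add: proj_eq_iff)
    moreover have "\<bar>c - c'\<bar> < 1" using c c' ab by auto
    ultimately have "c = c'" using Ints_nonzero_abs_ge1 by force
    then show False using c c' by simp
  qed
qed

lemma modulus_continuous_bound:
  assumes \<alpha>: "concave_modulus \<alpha>" and g: "modulus_continuous \<alpha> g"
  obtains C where "0 \<le> C" "\<And>x y. \<bar>g x - g y\<bar> \<le> C * \<alpha> (dist x y)"
proof -
  obtain C where C: "\<And>x y. x \<noteq> y \<Longrightarrow> \<bar>g x - g y\<bar> / \<alpha> (dist x y) \<le> C"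
    using g by (auto simp: modulus_continuous_def bdd_above_def)
  show thesis
  proof (rule that)
    \<comment> \<open>Taking the maximum with 0 spares an argument about the sign of
      \<open>C\<close>.\<close>
    show "0 \<le> max C 0" by simp
    fix x y
    show "\<bar>g x - g y\<bar> \<le> max C 0 * \<alpha> (dist x y)"
    proof (cases "x = y")
      case True
      then show ?thesis using concave_modulus_zero[OF \<alpha>] by simp
    next
      case False
      then have p: "0 < \<alpha> (dist x y)" by (simp add: concave_modulus_pos[OF \<alpha>])
      then have "\<bar>g x - g y\<bar> \<le> C * \<alpha> (dist x y)" using C[OF False] by (simp add: field_simps)
      also have "\<dots> \<le> max C 0 * \<alpha> (dist x y)" using p by (intro mult_right_mono) auto
      finally show ?thesis .
    qed
  qed
qed

text \<open>Adjoining the left endpoint enlarges \<open>J i\<close> to a longer interval, which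
  meets \<open>K\<close> by maximality. As \<open>J i\<close> itself misses \<open>K\<close>, the
  meeting point is the endpoint.\<close>

lemma left_endpoint_in_minimal_set:
  assumes J: "maximal_wandering_set f K J" and ab: "J i = proj ` {a<..<b}" "a < b" "b \<le> a + 1"
  shows "proj a \<in> K"
proof -
  have a: "proj a \<notin> J i"
  proof
    assume "proj a \<in> J i"
    then obtain y where y: "a < y" "y < b" "a - y \<in> \<int>" by (auto simp: ab proj_eq_iff)
    then have "\<bar>a - y\<bar> < 1" "a - y \<noteq> 0" using ab by auto
    then show False using Ints_nonzero_abs_ge1[OF y(3)] by simp
  qed
  have eq: "proj ` {a..<b} = insert (proj a) (J i)"
    using ab by (auto simp: image_iff less_le)
  have "circle_interval (proj ` {a..<b})"
    unfolding circle_interval_def by (intro exI[of _ "{a..<b}"]) (auto simp: is_interval_1)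
  moreover have "J i \<subset> proj ` {a..<b}" using a eq by auto
  ultimately have "proj ` {a..<b} \<inter> K \<noteq> {}" "J i \<subseteq> - K"
    using J by (auto simp: maximal_wandering_set_def)
  then show ?thesis using eq by auto
qed

section \<open>The integrability criterion\<close>

text \<open>Here \<open>inv_into {0..} \<alpha>\<close> is the inverse of \<alpha> on the half-line.
  The nonnegative integral takes the value \<infinity> on divergence, so the inequality asserts
  genuine convergence; the endpoints 0 and 1 form a null set.\<close>

theorem corollary1p5:
  fixes \<alpha> :: "real \<Rightarrow> real" and f :: "circle \<Rightarrow> circle"
    and K :: "circle set" and J :: "int \<Rightarrow> circle set" and l :: "int \<Rightarrow> real"
  assumes "concave_modulus \<alpha>"
    and "f \<in> Diff_plus \<alpha>"
    and "exceptional f"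
    and "exceptional_minimal_set f K"
    and "maximal_wandering_set f K J"
    and "\<And>i. l i = circle_length (J i)"
    and "((\<lambda>i. l (i + 1) / l i) \<longlongrightarrow> 1) at_top"
  shows "(\<integral>\<^sup>+ t\<in>{0<..<1}. ennreal (inv_into {0..} \<alpha> t / t\<^sup>2) \<partial>lborel) < \<infinity>"
proof -
  note \<alpha> = assms(1)
  have K: "minimal_set f K" using assms(4) by (simp add: exceptional_minimal_set_def)
  have bij: "bij f" using assms(2) by (simp add: Diff_plus_def)
  have cont: "continuous_on UNIV f" "continuous_on UNIV (inv f)"
    using assms(2) is_lift_continuous by (auto simp: Diff_plus_def circle_C1_def)
  have J: "\<And>i. open_circle_interval (J i)" "\<And>i j. i \<noteq> j \<Longrightarrow> J i \<inter> J j = {}"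
    "\<And>i. f ` J i = J (i + 1)"
    using assms(5) by (auto simp: maximal_wandering_set_def)
  obtain F where F: "is_lift F f" "strict_mono F"
    and F': "\<And>x. (F has_real_derivative circle_deriv f (proj x)) (at x)"
    using Diff_plus_lift[OF assms(2)] by blast
  obtain C where C: "0 \<le> C"
      "\<And>p q. \<bar>circle_deriv f p - circle_deriv f q\<bar> \<le> C * \<alpha> (dist p q)"
    using assms(2) modulus_continuous_bound[OF \<alpha>] by (auto simp: Diff_plus_def)
  obtain a0 b0 where ab0: "J 0 = proj ` {a0<..<b0}" "a0 < b0" "b0 \<le> a0 + 1"
    using J(1)[of 0] by (auto simp: open_circle_interval_def)
  \<comment> \<open>Iterating one fixed lift without reducing modulo 1 keeps each endpoint pair in a
    single interval of the line, so lengths are plain differences.\<close>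
  define a b where "a k = (F ^^ k) a0" and "b k = (F ^^ k) b0" for k
  have ab: "J (int k) = proj ` {a k<..<b k} \<and> a k < b k \<and> b k \<le> a k + 1" for k
  proof (induction k)
    case 0
    then show ?case using ab0 by (simp add: a_def b_def)
  next
    case (Suc k)
    have "J (int (Suc k)) = f ` J (int k)" using J(3)[of "int k"] by (simp add: add.commute)
    then show ?case
      using lift_image_interval[OF F bij_is_inj[OF bij], of "a k" "b k"] Suc
      by (simp add: a_def b_def)
  qed
  define m where "m k = l (int k)" for k
  have mab: "m k = b k - a k" for k
    using ab[of k] circle_length_interval[of "a k" "b k"] by (simp add: m_def assms(6))
  have mpos: "0 < m k" for k using ab[of k] by (simp add: mab)
  have summ: "summable m"
    unfolding m_def assms(6)
    by (rule summable_circle_length_disjoint) (use J in \<open>auto simp: disjoint_family_on_def\<close>)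
  have ratio: "(\<lambda>k. m (Suc k) / m k) \<longlonglongrightarrow> 1"
    using filterlim_compose[OF assms(7) filterlim_int_sequentially] by (simp add: m_def add.commute)
  have \<alpha>m: "(\<lambda>k. \<alpha> (m k)) \<longlonglongrightarrow> 0"
    using concave_modulus_tendsto_zero[OF \<alpha> summable_LIMSEQ_zero[OF summ]] mpos less_imp_le
    by blast
  \<comment> \<open>The mean value theorem gives the ratio as the derivative at some
    \<open>z\<close> in the interval, at distance at most \<open>m k\<close> from
    \<open>a k\<close>.\<close>
  have near: "\<bar>m (Suc k) / m k - circle_deriv f (proj (a k))\<bar> \<le> C * \<alpha> (m k)" for k
  proof -
    obtain z where z: "a k < z" "z < b k"
        "F (b k) - F (a k) = (b k - a k) * circle_deriv f (proj z)"
      using MVT2[of "a k" "b k" F "\<lambda>x. circle_deriv f (proj x)"] ab[of k] F' by blast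
    have "m (Suc k) / m k = circle_deriv f (proj z)"
      using z by (simp add: mab) (simp add: a_def b_def)
    moreover have "\<alpha> (dist (proj z) (proj (a k))) \<le> \<alpha> (m k)"
      using dist_proj_le[of z "a k"] z by (intro concave_modulus_mono[OF \<alpha>]) (auto simp: mab)
    then have "C * \<alpha> (dist (proj z) (proj (a k))) \<le> C * \<alpha> (m k)" using C(1) by (rule mult_left_mono)
    ultimately show ?thesis using C(2)[of "proj z" "proj (a k)"] by simp
  qed
  have orb: "proj (a k) = (f ^^ k) (proj a0)" for k
    using F(1) by (induction k) (auto simp: a_def is_lift_def)
  have aK: "proj (a k) \<in> K" for k
    using left_endpoint_in_minimal_set[OF assms(5)] ab[of k] by blast
  have deriv1: "circle_deriv f p = 1" if p: "p \<in> K" for p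
  proof -
    have "\<exists>k\<ge>n. dist (proj (a k)) p < inverse (real (Suc n))" for n
    proof -
      have "p \<in> closure ((\<lambda>k. proj (a k)) ` {n..})"
        using minimal_set_recurrent[OF K bij cont aK[of 0] p, of n]
        by (simp add: orb[abs_def])
      then obtain q where "q \<in> (\<lambda>k. proj (a k)) ` {n..}" "dist q p < inverse (real (Suc n))"
        unfolding closure_approachable by (metis inverse_positive_iff_positive of_nat_0_less_iff zero_less_Suc)
      then show ?thesis by auto
    qed
    \<comment> \<open>The indices \<open>\<kappa> n\<close> need not increase;
      \<open>n \<le> \<kappa> n\<close> already sends them to infinity, so limits along the orbit
      pass to them.\<close>
    then obtain \<kappa> where \<kappa>: "\<And>n. n \<le> \<kappa> n"
        "\<And>n. dist (proj (a (\<kappa> n))) p < inverse (real (Suc n))" by metis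
    have sub: "filterlim \<kappa> sequentially sequentially"
      by (rule filterlim_at_top_mono[OF filterlim_ident]) (use \<kappa>(1) in auto)
    have "(\<lambda>n. dist (proj (a (\<kappa> n))) p) \<longlonglongrightarrow> 0"
      by (rule tendsto_sandwich[OF _ _ tendsto_const LIMSEQ_inverse_real_of_nat])
        (auto intro!: always_eventually less_imp_le[OF \<kappa>(2)] simp del: of_nat_Suc)
    then have "(\<lambda>n. C * \<alpha> (dist (proj (a (\<kappa> n))) p)) \<longlonglongrightarrow> 0"
      by (intro tendsto_mult_right_zero concave_modulus_tendsto_zero[OF \<alpha>]) auto
    then have "(\<lambda>n. circle_deriv f (proj (a (\<kappa> n))) - circle_deriv f p) \<longlonglongrightarrow> 0"
      by (rule Lim_null_comparison[OF always_eventually, rotated]) (simp add: C(2))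
    moreover have "(\<lambda>k. C * \<alpha> (m k)) \<longlonglongrightarrow> 0" by (rule tendsto_mult_right_zero[OF \<alpha>m])
    then have "(\<lambda>k. m (Suc k) / m k - circle_deriv f (proj (a k))) \<longlonglongrightarrow> 0"
      by (rule Lim_null_comparison[OF always_eventually, rotated]) (simp add: near)
    \<comment> \<open>Subtracting the vanishing error from the ratio leaves the derivative along the
      orbit, so that derivative tends to 1. The same device then isolates
      \<open>circle_deriv f p\<close>.\<close>
    then have "(\<lambda>k. m (Suc k) / m k - (m (Suc k) / m k - circle_deriv f (proj (a k)))) \<longlonglongrightarrow> 1 - 0"
      by (intro tendsto_diff ratio)
    then have "(\<lambda>k. circle_deriv f (proj (a k))) \<longlonglongrightarrow> 1" by simp
    then have "(\<lambda>n. circle_deriv f (proj (a (\<kappa> n)))) \<longlonglongrightarrow> 1"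
      by (rule filterlim_compose[OF _ sub])
    ultimately have "(\<lambda>n. circle_deriv f (proj (a (\<kappa> n)))
        - (circle_deriv f (proj (a (\<kappa> n))) - circle_deriv f p)) \<longlonglongrightarrow> 1 - 0"
      by (intro tendsto_diff)
    then show ?thesis by (simp add: LIMSEQ_const_iff)
  qed
  \<comment> \<open>Every \<open>proj (a k)\<close> lies in \<open>K\<close>, where the derivative
    is exactly 1, so \<open>near\<close> now compares the ratio with 1.\<close>
  have rate: "m k - m (Suc k) \<le> C * m k * \<alpha> (m k)" for k
  proof -
    have "1 - m (Suc k) / m k \<le> C * \<alpha> (m k)" using near[of k] deriv1[OF aK[of k]] by auto
    then show ?thesis using mpos[of k] by (simp add: field_simps)
  qed
  \<comment> \<open>The threshold 1/2 yields the halving hypothesis of the integral estimate from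
    index \<open>N\<close> on; the shifted sequence remains summable.\<close>
  obtain N where N: "\<And>k. N \<le> k \<Longrightarrow> 1 / 2 < m (Suc k) / m k"
    using order_tendstoD(1)[OF ratio, of "1 / 2"] by (auto simp: eventually_sequentially)
  show ?thesis
  proof (rule integrable_inverse_modulus[OF \<alpha>])
    show "summable (\<lambda>k. m (k + N))" using summ by (subst summable_iff_shift)
    show "m (k + N) \<le> 2 * m (Suc k + N)" for k
      using N[of "k + N"] mpos[of "k + N"] by (simp add: field_simps)
    show "m (k + N) - m (Suc k + N) \<le> C * m (k + N) * \<alpha> (m (k + N))" for k
      using rate[of "k + N"] by simp
  qed (use mpos C in auto)
qed

end
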